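(* Let $E$ and $F$ be Banach spaces over the same scalar field ($\mathbb{R}$ or $\mathbb{C}$). Given a positive integer $k$ there exists a constant $C_k$ such that for every continuous $k$-homogeneous polynomial $P\in\mathcal{P}(^kE,F)$ and every finite sequence $x_1,\dots,x_n\in E$, $$\sup_{|\epsilon_j|\le 1}\left\|\sum_{j=1}^n \epsilon_j P(x_j)\right\| \le C_k \sup_{|\nu_j|\le 1}\left\|P\left(\sum_{j=1}^n \nu_j x_j\right)\right\|,$$ where both suprema are over all choices of scalars $\epsilon_1,\dots,\epsilon_n$ (respectively $\nu_1,\dots,\nu_n$) in the scalar field of modulus at most $1$. Moreover, in the complex case one can take $C_k=1$ for every $k$, and in the real case one can take $C_k=(2k)^k/k!$.
   Context: $\mathcal{P}(^kE,F)$ denotes the space of continuous $k$-homogeneous polynomials from $E$ to $F$, i.e. maps of the form $x\mapsto \hat P(x,\dots,x)$ with $\hat P:E^k\to F$ a continuous (symmetric) $k$-linear map. *)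

theory Defs
  imports "HOL-Analysis.Analysis"
begin

text \<open>
  A complex Banach space. The class \<^class>\<open>banach\<close> contributes the addition, the complete norm and
  the underlying real scalar multiplication, with which the complex one has to agree.
\<close>

class complex_banach = banach +
  fixes scaleC :: "complex \<Rightarrow> 'a \<Rightarrow> 'a"
  assumes scaleC_add_right: "scaleC a (x + y) = scaleC a x + scaleC a y"
    and scaleC_add_left: "scaleC (a + b) x = scaleC a x + scaleC b x"
    and scaleC_scaleC: "scaleC a (scaleC b x) = scaleC (a * b) x"
    and scaleC_one: "scaleC 1 x = x"
    and scaleC_of_real: "scaleC (complex_of_real r) x = scaleR r x"
    and norm_scaleC: "norm (scaleC a x) = cmod a * norm x"

interpretation complex_banach:
  vector_space "scaleC :: complex \<Rightarrow> 'a \<Rightarrow> 'a::complex_banach"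
  by unfold_locales
    (simp_all add: scaleC_add_right scaleC_add_left scaleC_scaleC scaleC_one)

instantiation complex :: complex_banach
begin

definition scaleC_complex :: "complex \<Rightarrow> complex \<Rightarrow> complex" where
  "scaleC_complex a x = a * x"

instance
  by standard (simp_all add: scaleC_complex_def algebra_simps norm_mult scaleR_conv_of_real)

end

text \<open>
  The scalar field is the type \<open>'k\<close>; the scalar multiplications \<open>sE\<close> and \<open>sF\<close> of the two spaces are
  parameters, so that the same definitions serve real spaces (with \<^const>\<open>scaleR\<close>) and complex
  spaces (with \<^const>\<open>scaleC\<close>). The power \<open>E\<^sup>k\<close> is the set \<open>{..<k} \<rightarrow>\<^sub>E UNIV\<close>, which is
  the underlying set of the product topology used below.
\<close>

definition multilinear ::
  "('k::field \<Rightarrow> 'a::ab_group_add \<Rightarrow> 'a) \<Rightarrow> ('k \<Rightarrow> 'b::ab_group_add \<Rightarrow> 'b) \<Rightarrow> nat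
    \<Rightarrow> ((nat \<Rightarrow> 'a) \<Rightarrow> 'b) \<Rightarrow> bool" where
  "multilinear sE sF k A \<longleftrightarrow>
    (\<forall>v \<in> {..<k} \<rightarrow>\<^sub>E UNIV. \<forall>i<k. Vector_Spaces.linear sE sF (\<lambda>x. A (v(i := x))))"

text \<open>
  Symmetry of the \<open>k\<close>-linear map is not required: replacing the map by its symmetrization does not
  change the polynomial, so requiring it would give the same set.
\<close>

definition homogeneous_polynomials ::
  "('k::field \<Rightarrow> 'a::real_normed_vector \<Rightarrow> 'a) \<Rightarrow> ('k \<Rightarrow> 'b::real_normed_vector \<Rightarrow> 'b) \<Rightarrow> nat
    \<Rightarrow> ('a \<Rightarrow> 'b) set" where
  "homogeneous_polynomials sE sF k =
    {P. \<exists>A. multilinear sE sF k A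
          \<and> continuous_map (product_topology (\<lambda>_. euclidean) {..<k}) euclidean A
          \<and> (\<forall>x. P x = A (\<lambda>i\<in>{..<k}. x))}"

text \<open>
  The inequality with constant \<open>C\<close>, for all polynomials and all finite sequences
  \<open>x 0, \<dots>, x (n - 1)\<close>. Both suprema are taken over nonempty bounded sets of reals, the polynomial
  being continuous and the coefficients ranging over a compact set.
\<close>

definition unconditional_bound ::
  "('k::real_normed_field \<Rightarrow> 'a::real_normed_vector \<Rightarrow> 'a)
    \<Rightarrow> ('k \<Rightarrow> 'b::real_normed_vector \<Rightarrow> 'b) \<Rightarrow> nat \<Rightarrow> real \<Rightarrow> bool" where
  "unconditional_bound sE sF k C \<longleftrightarrow>
    (\<forall>P \<in> homogeneous_polynomials sE sF k. \<forall>n. \<forall>x :: nat \<Rightarrow> 'a.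
      (SUP \<epsilon> \<in> {\<epsilon> :: nat \<Rightarrow> 'k. \<forall>j<n. norm (\<epsilon> j) \<le> 1}. norm (\<Sum>j<n. sF (\<epsilon> j) (P (x j))))
      \<le> C * (SUP \<nu> \<in> {\<nu> :: nat \<Rightarrow> 'k. \<forall>j<n. norm (\<nu> j) \<le> 1}. norm (P (\<Sum>j<n. sE (\<nu> j) (x j)))))"

end

theory Submission
  imports Defs
begin

text \<open>
  Let \<open>P\<close> be the restriction to the diagonal of the \<open>k\<close>-linear map \<open>A\<close>. Both inequalities come from
  writing \<open>\<Sum>j. \<epsilon> j P(x j)\<close> as an average of values of \<open>A\<close> at linear combinations of the \<open>x j\<close>. If the
  \<open>i\<close>-th argument of \<open>A\<close> is \<open>\<Sum>j. c i j x j\<close>, multilinear expansion gives one term for each index tuple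
  \<open>J\<close>, with coefficient \<open>\<Prod>i. c i (J i)\<close>; the \<open>c i j\<close> are random and chosen so that the
  expectation of this product is \<open>\<epsilon> j\<close> if \<open>J\<close> is constantly \<open>j\<close>, and 0 if \<open>J\<close> is not constant
  (\<open>multilinear_sum_diagonal\<close>).

  In the complex case, take \<open>c i j = w j d j\<close> with \<open>d j\<close> a \<open>k\<close>-th root of \<open>\<epsilon> j\<close> and the \<open>w j\<close> independent
  and uniform on the \<open>k\<close>-th roots of unity. If \<open>J\<close> is not constant, some \<open>w j\<close> occurs in the product with
  an exponent strictly between 0 and \<open>k\<close>, and the mean is 0. As \<open>c i j\<close> does not depend on
  \<open>i\<close>, only values of \<open>P\<close> on the unit polydisc are averaged, which gives the constant 1.

  Real scalars lack these roots of unity. There the first \<open>k - 1\<close> arguments of \<open>A\<close> get independent families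
  of random signs, and the last one gets \<open>\<epsilon>\<close> times the product of these families
  (\<open>entangled_signs\<close>). Now the arguments of \<open>A\<close> differ, so that the values of \<open>A\<close> have to be bounded by
  values of \<open>P\<close>. The polarization formula does this, at the cost of the factor \<open>k\<^sup>k / k!\<close>, which
  is at most \<open>(2k)\<^sup>k / k!\<close>. It bounds a sum of \<open>A\<close> over the permutations of its arguments, which is
  enough, since permuting the arguments does not change the average.
\<close>

section \<open>Averages over products of groups of roots of unity\<close>

text \<open>
  The factor \<open>z\<close> that appears when one coordinate is multiplied by \<open>z\<close> records how often the product
  uses that coordinate. This is how the three averages below detect the shape of an index tuple.
\<close>

lemma prod_rotate_coordinate:
  fixes w :: "'x \<Rightarrow> 'k::comm_monoid_mult"
  assumes "finite S"
  shows "(\<Prod>i\<in>S. (w(a := z * w a)) (g i)) = z ^ card {i \<in> S. g i = a} * (\<Prod>i\<in>S. w (g i))"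
proof -
  have "(\<Prod>i\<in>S. (w(a := z * w a)) (g i)) = (\<Prod>i\<in>S. (if g i = a then z else 1) * w (g i))"
    by (rule prod.cong) auto
  also have "\<dots> = (\<Prod>i\<in>S. if g i = a then z else 1) * (\<Prod>i\<in>S. w (g i))"
    by (rule prod.distrib)
  also have "(\<Prod>i\<in>S. if g i = a then z else 1) = z ^ card {i \<in> S. g i = a}"
    using assms by (simp flip: prod.inter_filter)
  finally show ?thesis .
qed

text \<open>
  Multiplying one coordinate by \<open>z\<close> permutes the points of the product, so the sum equals \<open>t\<close> times
  itself.
\<close>

lemma sum_eq_0_by_rotation:
  fixes G :: "('x \<Rightarrow> 'k::field) \<Rightarrow> 'k"
  assumes a: "a \<in> X" and z: "z \<noteq> 0"
    and R: "\<And>y. y \<in> R \<Longrightarrow> z * y \<in> R" "\<And>y. y \<in> R \<Longrightarrow> inverse z * y \<in> R"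
    and G: "\<And>w. w \<in> X \<rightarrow>\<^sub>E R \<Longrightarrow> G (w(a := z * w a)) = t * G w"
    and t: "t \<noteq> 1"
  shows "(\<Sum>w\<in>X \<rightarrow>\<^sub>E R. G w) = 0"
proof -
  have closed: "w(a := y * w a) \<in> X \<rightarrow>\<^sub>E R" if "w \<in> X \<rightarrow>\<^sub>E R" "\<And>r. r \<in> R \<Longrightarrow> y * r \<in> R" for w y
    using that a by (auto simp: PiE_iff extensional_def)
  have "bij_betw (\<lambda>w. w(a := z * w a)) (X \<rightarrow>\<^sub>E R) (X \<rightarrow>\<^sub>E R)"
  proof (rule bij_betw_byWitness[where f' = "\<lambda>w. w(a := inverse z * w a)"])
    show "\<forall>w\<in>X \<rightarrow>\<^sub>E R. (w(a := z * w a))(a := inverse z * (w(a := z * w a)) a) = w"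
      using z by (auto simp: fun_eq_iff)
    show "\<forall>w\<in>X \<rightarrow>\<^sub>E R. (w(a := inverse z * w a))(a := z * (w(a := inverse z * w a)) a) = w"
      using z by (auto simp: fun_eq_iff)
    show "(\<lambda>w. w(a := z * w a)) ` (X \<rightarrow>\<^sub>E R) \<subseteq> X \<rightarrow>\<^sub>E R"
      using closed R(1) by blast
    show "(\<lambda>w. w(a := inverse z * w a)) ` (X \<rightarrow>\<^sub>E R) \<subseteq> X \<rightarrow>\<^sub>E R"
      using closed R(2) by blast
  qed
  then have "(\<Sum>w\<in>X \<rightarrow>\<^sub>E R. G w) = (\<Sum>w\<in>X \<rightarrow>\<^sub>E R. G (w(a := z * w a)))"
    by (rule sum.reindex_bij_betw[symmetric])
  also have "\<dots> = t * (\<Sum>w\<in>X \<rightarrow>\<^sub>E R. G w)"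
    by (simp add: G sum_distrib_left)
  finally have "(1 - t) * (\<Sum>w\<in>X \<rightarrow>\<^sub>E R. G w) = 0"
    by (simp add: algebra_simps)
  then show ?thesis
    using t by simp
qed

text \<open>
  If the tuple is not constant, the coordinate \<open>J 0\<close> enters the product with an exponent \<open>c\<close> such that
  \<open>0 < c < k\<close>. Rotating it by a primitive root of unity \<open>z\<close> then gives the factor \<open>z ^ c \<noteq> 1\<close>.
\<close>

lemma sum_roots_of_unity_prod:
  fixes J :: "nat \<Rightarrow> nat"
  assumes k: "1 \<le> k" and J: "\<And>i. i < k \<Longrightarrow> J i < n"
  shows "(\<Sum>w\<in>{..<n} \<rightarrow>\<^sub>E {z::complex. z ^ k = 1}. \<Prod>i<k. w (J i))
    = (if J constant_on {..<k} then of_nat (card ({..<n} \<rightarrow>\<^sub>E {z::complex. z ^ k = 1})) else 0)"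
proof (cases "J constant_on {..<k}")
  case True
  have "(\<Prod>i<k. w (J i)) = 1" if "w \<in> {..<n} \<rightarrow>\<^sub>E {z::complex. z ^ k = 1}" for w
  proof -
    have "w (J 0) ^ k = 1"
      using PiE_mem[OF that, of "J 0"] J k by auto
    moreover have "(\<Prod>i<k. w (J i)) = (\<Prod>i<k. w (J 0))"
      using True k by (intro prod.cong refl arg_cong[where f = w]) (auto simp: constant_on_def)
    ultimately show ?thesis
      by simp
  qed
  then show ?thesis
    using True by simp
next
  case False
  define c where "c = card {i \<in> {..<k}. J i = J 0}"
  define z :: complex where "z = exp (2 * of_real pi * \<i> * of_nat 1 / of_nat k)"
  obtain i1 where i1: "i1 < k" "J i1 \<noteq> J 0"
    using False k by (auto simp: constant_on_def)
  have "{i \<in> {..<k}. J i = J 0} \<subset> {..<k}"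
    using i1 by auto
  then have "c < k"
    unfolding c_def using psubset_card_mono[of "{..<k}" "{i \<in> {..<k}. J i = J 0}"] by simp
  moreover have "0 < c"
    unfolding c_def using k by (auto simp: card_gt_0_iff intro!: exI[of _ 0])
  ultimately have "\<not> k dvd c"
    by (auto dest: dvd_imp_le)
  moreover have "z ^ c = exp (2 * of_real pi * \<i> * of_nat c / of_nat k)"
    unfolding z_def by (simp flip: exp_of_nat_mult add: field_simps)
  ultimately have zc: "z ^ c \<noteq> 1"
    using complex_root_unity_eq_1[OF k] by simp
  have zk: "z ^ k = 1"
    unfolding z_def using complex_root_unity[of k 1] k by simp
  have "(\<Sum>w\<in>{..<n} \<rightarrow>\<^sub>E {z::complex. z ^ k = 1}. \<Prod>i<k. w (J i)) = 0"
  proof (rule sum_eq_0_by_rotation[where a = "J 0" and z = z and t = "z ^ c"])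
    show "J 0 \<in> {..<n}"
      using J k by simp
    show "z \<noteq> 0"
      by (simp add: z_def)
    show "(\<Prod>i<k. (w(J 0 := z * w (J 0))) (J i)) = z ^ c * (\<Prod>i<k. w (J i))" for w
      unfolding c_def by (rule prod_rotate_coordinate) simp
  qed (use zk zc in \<open>auto simp: power_mult_distrib field_simps\<close>)
  with False show ?thesis
    by simp
qed

text \<open>
  For a sign pattern \<open>r\<close>, the rows \<open>i < m\<close> are free and the row \<open>m\<close> is determined by them, in such a way
  that the \<open>m + 1\<close> entries of the column \<open>j\<close> multiply to \<open>\<epsilon> j\<close>.
\<close>

definition entangled_signs ::
  "nat \<Rightarrow> (nat \<Rightarrow> 'k::comm_monoid_mult) \<Rightarrow> (nat \<times> nat \<Rightarrow> 'k) \<Rightarrow> nat \<Rightarrow> nat \<Rightarrow> 'k" where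
  "entangled_signs m \<epsilon> r i j = (if i < m then r (i, j) else \<epsilon> j * (\<Prod>h<m. r (h, j)))"

text \<open>
  The row \<open>m\<close> pairs each sign \<open>r (i, J i)\<close> with \<open>r (i, J m)\<close>. The two cancel if \<open>J i = J m\<close>; otherwise
  \<open>r (i, J i)\<close> occurs exactly once in the product, and flipping it changes only the sign.
\<close>

lemma sum_entangled_signs_prod:
  fixes J :: "nat \<Rightarrow> nat" and \<epsilon> :: "nat \<Rightarrow> 'k::real_normed_field"
  assumes J: "\<And>i. i < Suc m \<Longrightarrow> J i < n"
  shows "(\<Sum>r\<in>{..<m} \<times> {..<n} \<rightarrow>\<^sub>E {-1, 1}. \<Prod>i<Suc m. entangled_signs m \<epsilon> r i (J i))
    = (if J constant_on {..<Suc m}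
       then of_nat (card ({..<m} \<times> {..<n} \<rightarrow>\<^sub>E {-1, 1::'k})) * \<epsilon> (J 0) else 0)"
proof -
  let ?W = "{..<m} \<times> {..<n} \<rightarrow>\<^sub>E {-1, 1::'k}"
  have eq: "(\<Prod>i<Suc m. entangled_signs m \<epsilon> r i (J i))
      = \<epsilon> (J m) * ((\<Prod>i<m. r (i, J i)) * (\<Prod>i<m. r (i, J m)))" for r
    by (simp add: entangled_signs_def)
  show ?thesis
  proof (cases "J constant_on {..<Suc m}")
    case True
    have "(\<Prod>i<m. r (i, J i)) * (\<Prod>i<m. r (i, J m)) = 1" if "r \<in> ?W" for r
    proof -
      have "r (i, J i) * r (i, J m) = 1" if "i < m" for i
      proof -
        have "r (i, J m) \<in> {-1, 1}"
          using \<open>r \<in> ?W\<close> that J[of m] by (auto dest!: PiE_mem)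
        moreover have "J i = J m"
          using True that by (auto simp: constant_on_def)
        ultimately show ?thesis
          by auto
      qed
      then show ?thesis
        by (simp flip: prod.distrib)
    qed
    moreover have "J m = J 0"
      using True by (auto simp: constant_on_def)
    ultimately show ?thesis
      using True unfolding eq by simp
  next
    case False
    have "\<not> (\<forall>i<m. J i = J m)"
    proof
      assume "\<forall>i<m. J i = J m"
      then have "\<forall>i\<in>{..<Suc m}. J i = J m"
        by (auto simp: less_Suc_eq)
      with False show False
        unfolding constant_on_def by blast
    qed
    then obtain i0 where i0: "i0 < m" "J i0 \<noteq> J m"
      by blast
    have "(\<Sum>r\<in>?W. \<epsilon> (J m) * ((\<Prod>i<m. r (i, J i)) * (\<Prod>i<m. r (i, J m)))) = 0"
    proof (rule sum_eq_0_by_rotation[where a = "(i0, J i0)" and z = "-1" and t = "-1"])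
      show "(i0, J i0) \<in> {..<m} \<times> {..<n}"
        using i0 J by simp
      fix r :: "nat \<times> nat \<Rightarrow> 'k"
      have sets: "{i \<in> {..<m}. (i, J i) = (i0, J i0)} = {i0}" "{i \<in> {..<m}. (i, J m) = (i0, J i0)} = {}"
        using i0 by auto
      then show "\<epsilon> (J m) * ((\<Prod>i<m. (r((i0, J i0) := -1 * r (i0, J i0))) (i, J i))
            * (\<Prod>i<m. (r((i0, J i0) := -1 * r (i0, J i0))) (i, J m)))
          = -1 * (\<epsilon> (J m) * ((\<Prod>i<m. r (i, J i)) * (\<Prod>i<m. r (i, J m))))"
        using prod_rotate_coordinate[of "{..<m}" r "(i0, J i0)" "-1" "\<lambda>i. (i, J i)"]
          prod_rotate_coordinate[of "{..<m}" r "(i0, J i0)" "-1" "\<lambda>i. (i, J m)"]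
        unfolding sets by simp
    qed auto
    with False show ?thesis
      unfolding eq by simp
  qed
qed

text \<open>
  If \<open>J\<close> is injective, it permutes the indices and both products are equal. Otherwise it misses an index
  \<open>b\<close>, and \<open>w b\<close> occurs exactly once.
\<close>

lemma sum_signs_prod:
  fixes J :: "nat \<Rightarrow> nat"
  assumes J: "\<And>i. i < k \<Longrightarrow> J i < k"
  shows "(\<Sum>w\<in>{..<k} \<rightarrow>\<^sub>E {-1, 1::'k::real_normed_field}. (\<Prod>i<k. w i) * (\<Prod>i<k. w (J i)))
    = (if inj_on J {..<k} then of_nat (card ({..<k} \<rightarrow>\<^sub>E {-1, 1::'k})) else 0)"
proof (cases "inj_on J {..<k}")
  case True
  then have "bij_betw J {..<k} {..<k}"
    using J endo_inj_surj[of "{..<k}" J] by (simp add: bij_betw_def image_subset_iff)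
  have "(\<Prod>i<k. w i) * (\<Prod>i<k. w (J i)) = 1" if "w \<in> {..<k} \<rightarrow>\<^sub>E {-1, 1::'k}" for w
  proof -
    have "(\<Prod>i<k. w (J i)) = (\<Prod>i<k. w i)"
      using \<open>bij_betw J {..<k} {..<k}\<close> by (rule prod.reindex_bij_betw)
    moreover have "w i * w i = 1" if "i < k" for i
      using PiE_mem[OF \<open>w \<in> _\<close>, of i] that by auto
    ultimately show ?thesis
      by (simp flip: prod.distrib)
  qed
  then show ?thesis
    using True by simp
next
  case False
  then have "J ` {..<k} \<noteq> {..<k}"
    using eq_card_imp_inj_on[of "{..<k}" J] by auto
  then obtain b where b: "b < k" "b \<notin> J ` {..<k}"
    using J by auto
  have "(\<Sum>w\<in>{..<k} \<rightarrow>\<^sub>E {-1, 1::'k}. (\<Prod>i<k. w i) * (\<Prod>i<k. w (J i))) = 0"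
  proof (rule sum_eq_0_by_rotation[where a = b and z = "-1" and t = "-1"])
    show "b \<in> {..<k}"
      using b by simp
    fix w :: "nat \<Rightarrow> 'k"
    have "{i \<in> {..<k}. i = b} = {b}" "{i \<in> {..<k}. J i = b} = {}"
      using b by auto
    then show "(\<Prod>i<k. (w(b := -1 * w b)) i) * (\<Prod>i<k. (w(b := -1 * w b)) (J i))
        = -1 * ((\<Prod>i<k. w i) * (\<Prod>i<k. w (J i)))"
      using prod_rotate_coordinate[of "{..<k}" w b "-1" "\<lambda>i. i"]
        prod_rotate_coordinate[of "{..<k}" w b "-1" J] by simp
  qed auto
  with False show ?thesis
    by simp
qed

section \<open>Expanding a multilinear map\<close>

lemma multilinear_vector_spaces:
  assumes "multilinear sE sF k A" "1 \<le> k"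
  shows "vector_space sE" "vector_space sF"
proof -
  have "Vector_Spaces.linear sE sF (\<lambda>x. A ((\<lambda>i\<in>{..<k}. undefined)(0 := x)))"
    using assms unfolding multilinear_def by auto
  then interpret L: Vector_Spaces.linear sE sF "\<lambda>x. A ((\<lambda>i\<in>{..<k}. undefined)(0 := x))" .
  show "vector_space sE" "vector_space sF"
    by (rule L.vs1.vector_space_axioms, rule L.vs2.vector_space_axioms)
qed

text \<open>
  The arguments are expanded one at a time: in the induction the first \<open>m\<close> arguments are linear
  combinations, and the others are an arbitrary tuple \<open>v\<close>.
\<close>

lemma multilinear_expand:
  assumes A: "multilinear sE sF k A" and k: "1 \<le> k" and I: "finite I"
  shows "A (\<lambda>i\<in>{..<k}. \<Sum>j\<in>I. sE (c i j) (x j))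
    = (\<Sum>J\<in>{..<k} \<rightarrow>\<^sub>E I. sF (\<Prod>i<k. c i (J i)) (A (\<lambda>i\<in>{..<k}. x (J i))))"
proof -
  interpret F: vector_space sF
    using multilinear_vector_spaces[OF A k] by simp
  define S where "S i = (\<Sum>j\<in>I. sE (c i j) (x j))" for i
  have step: "A (\<lambda>i\<in>{..<k}. if i < m then S i else v i)
    = (\<Sum>J\<in>{..<m} \<rightarrow>\<^sub>E I. sF (\<Prod>i<m. c i (J i)) (A (\<lambda>i\<in>{..<k}. if i < m then x (J i) else v i)))"
    if "m \<le> k" for m v
    using that
  proof (induction m arbitrary: v)
    case 0
    show ?case by simp
  next
    case (Suc m)
    let ?u = "\<lambda>i\<in>{..<k}. if i < m then S i else v i"
    have lin: "Vector_Spaces.linear sE sF (\<lambda>y. A (?u(m := y)))"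
      using A Suc.prems unfolding multilinear_def by auto
    interpret L: Vector_Spaces.linear sE sF "\<lambda>y. A (?u(m := y))"
      by (rule lin)
    have upd: "?u(m := y) = (\<lambda>i\<in>{..<k}. if i < m then S i else (v(m := y)) i)" for y
      using Suc.prems by (auto simp: fun_eq_iff)
    let ?T = "\<lambda>J. sF (\<Prod>i<Suc m. c i (J i)) (A (\<lambda>i\<in>{..<k}. if i < Suc m then x (J i) else v i))"
    have "A (\<lambda>i\<in>{..<k}. if i < Suc m then S i else v i) = A (?u(m := S m))"
      using Suc.prems by (intro arg_cong[where f = A]) (auto simp: fun_eq_iff less_Suc_eq)
    also have "\<dots> = (\<Sum>j\<in>I. sF (c m j) (A (?u(m := x j))))"
      unfolding S_def[of m] by (simp only: L.sum L.scale)
    also have "\<dots> = (\<Sum>j\<in>I. \<Sum>J\<in>{..<m} \<rightarrow>\<^sub>E I. ?T (J(m := j)))"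
    proof (intro sum.cong refl)
      fix j
      have "(\<lambda>i\<in>{..<k}. if i < m then x (J i) else (v(m := x j)) i)
          = (\<lambda>i\<in>{..<k}. if i < Suc m then x ((J(m := j)) i) else v i)" for J
        by (auto simp: fun_eq_iff less_Suc_eq)
      moreover have "(\<Prod>i<Suc m. c i ((J(m := j)) i)) = c m j * (\<Prod>i<m. c i (J i))" for J
        by (simp add: mult.commute)
      ultimately show "sF (c m j) (A (?u(m := x j))) = (\<Sum>J\<in>{..<m} \<rightarrow>\<^sub>E I. ?T (J(m := j)))"
        unfolding upd using Suc.IH[of "v(m := x j)"] Suc.prems
        by (simp only: F.scale_sum_right F.scale_scale Suc_leD)
    qed
    also have "\<dots> = (\<Sum>(j, J)\<in>I \<times> ({..<m} \<rightarrow>\<^sub>E I). ?T (J(m := j)))"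
      by (rule sum.cartesian_product)
    also have "\<dots> = (\<Sum>J\<in>(\<lambda>(j, J). J(m := j)) ` (I \<times> ({..<m} \<rightarrow>\<^sub>E I)). ?T J)"
      by (subst sum.reindex) (use inj_combinator[of m "{..<m}" "\<lambda>_. I"] in \<open>auto simp: case_prod_unfold\<close>)
    also have "(\<lambda>(j, J). J(m := j)) ` (I \<times> ({..<m} \<rightarrow>\<^sub>E I)) = {..<Suc m} \<rightarrow>\<^sub>E I"
      by (simp add: lessThan_Suc PiE_insert_eq)
    finally show ?case .
  qed
  have "A (\<lambda>i\<in>{..<k}. S i) = A (\<lambda>i\<in>{..<k}. if i < k then S i else undefined)"
    by (simp cong: restrict_cong)
  also have "\<dots> = (\<Sum>J\<in>{..<k} \<rightarrow>\<^sub>E I. sF (\<Prod>i<k. c i (J i))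
      (A (\<lambda>i\<in>{..<k}. if i < k then x (J i) else undefined)))"
    using step[of k "\<lambda>_. undefined"] by simp
  also have "\<dots> = (\<Sum>J\<in>{..<k} \<rightarrow>\<^sub>E I. sF (\<Prod>i<k. c i (J i)) (A (\<lambda>i\<in>{..<k}. x (J i))))"
    by (simp cong: restrict_cong)
  finally show ?thesis
    unfolding S_def .
qed

lemma multilinear_scale_diagonal:
  assumes A: "multilinear sE sF k A" and k: "1 \<le> k"
  shows "A (\<lambda>i\<in>{..<k}. sE c y) = sF (c ^ k) (A (\<lambda>i\<in>{..<k}. y))"
  using multilinear_expand[OF A k, of "{()}" "\<lambda>_ _. c" "\<lambda>_. y"] by simp

lemma multilinear_sum_expand:
  assumes A: "multilinear sE sF k A" and k: "1 \<le> k" and I: "finite I"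
  shows "(\<Sum>w\<in>W. sF (g w) (A (\<lambda>i\<in>{..<k}. \<Sum>j\<in>I. sE (c w i j) (x j))))
    = (\<Sum>J\<in>{..<k} \<rightarrow>\<^sub>E I. sF (\<Sum>w\<in>W. g w * (\<Prod>i<k. c w i (J i))) (A (\<lambda>i\<in>{..<k}. x (J i))))"
proof -
  interpret F: vector_space sF
    using multilinear_vector_spaces[OF A k] by simp
  show ?thesis
    by (simp add: multilinear_expand[OF A k I] F.scale_sum_right F.scale_sum_left)
      (rule sum.swap)
qed

text \<open>
  If the coefficients \<open>c\<close> average out for all nonconstant index tuples, only the terms on the diagonal
  survive, and these are values of the polynomial.
\<close>

lemma multilinear_sum_diagonal:
  fixes A :: "(nat \<Rightarrow> 'a::ab_group_add) \<Rightarrow> 'b::ab_group_add"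
  assumes A: "multilinear sE sF k A" and k: "1 \<le> k" and I: "finite I"
    and c: "\<And>J. J \<in> {..<k} \<rightarrow>\<^sub>E I \<Longrightarrow>
      (\<Sum>w\<in>W. \<Prod>i<k. c w i (J i)) = (if J constant_on {..<k} then N * e (J 0) else 0)"
  shows "(\<Sum>w\<in>W. A (\<lambda>i\<in>{..<k}. \<Sum>j\<in>I. sE (c w i j) (x j)))
    = sF N (\<Sum>j\<in>I. sF (e j) (A (\<lambda>i\<in>{..<k}. x j)))"
proof -
  interpret F: vector_space sF
    using multilinear_vector_spaces[OF A k] by simp
  let ?D = "{J \<in> {..<k} \<rightarrow>\<^sub>E I. J constant_on {..<k}}"
  have D: "?D = (\<lambda>j. \<lambda>i\<in>{..<k}. j) ` I"
  proof (intro subset_antisym subsetI)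
    fix J assume J: "J \<in> ?D"
    then have "J = (\<lambda>i\<in>{..<k}. J 0)"
      using k by (auto simp: fun_eq_iff PiE_iff extensional_def constant_on_def)
    moreover have "J 0 \<in> I"
      using J k PiE_mem[of J "{..<k}" "\<lambda>_. I" 0] by simp
    ultimately show "J \<in> (\<lambda>j. \<lambda>i\<in>{..<k}. j) ` I"
      by blast
  qed (auto simp: constant_on_def split: if_splits)
  have inj: "inj_on (\<lambda>j. \<lambda>i\<in>{..<k}. j) I"
  proof (rule inj_onI)
    fix j j' assume "(\<lambda>i\<in>{..<k}. j) = (\<lambda>i\<in>{..<k}. j')"
    from fun_cong[OF this, of 0] show "j = j'"
      using k by simp
  qed
  have "(\<Sum>w\<in>W. A (\<lambda>i\<in>{..<k}. \<Sum>j\<in>I. sE (c w i j) (x j)))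
      = (\<Sum>J\<in>{..<k} \<rightarrow>\<^sub>E I. sF (\<Sum>w\<in>W. \<Prod>i<k. c w i (J i)) (A (\<lambda>i\<in>{..<k}. x (J i))))"
    using multilinear_sum_expand[OF A k I, where g = "\<lambda>_. 1"] by simp
  also have "\<dots> = (\<Sum>J\<in>{..<k} \<rightarrow>\<^sub>E I.
      if J constant_on {..<k} then sF (N * e (J 0)) (A (\<lambda>i\<in>{..<k}. x (J i))) else 0)"
    by (intro sum.cong) (simp_all add: c)
  also have "\<dots> = (\<Sum>J\<in>?D. sF (N * e (J 0)) (A (\<lambda>i\<in>{..<k}. x (J i))))"
    using I by (intro sum.inter_filter[symmetric]) (simp add: finite_PiE)
  also have "\<dots> = (\<Sum>j\<in>I. sF (N * e j) (A (\<lambda>i\<in>{..<k}. x j)))"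
    unfolding D using k by (simp add: sum.reindex[OF inj] cong: restrict_cong)
  finally show ?thesis
    by (simp add: F.scale_sum_right)
qed

section \<open>Polarization\<close>

text \<open>
  Expanding \<open>A\<close> at \<open>\<Sum>j. w j u j\<close> in all arguments and averaging against \<open>\<Prod>i. w i\<close> keeps exactly the
  index tuples that use each index once. As \<open>A\<close> may fail to be symmetric, these do not combine into a
  multiple of one value.
\<close>

lemma polarization:
  fixes A :: "(nat \<Rightarrow> 'a::ab_group_add) \<Rightarrow> 'b::ab_group_add"
    and sE :: "'k::real_normed_field \<Rightarrow> 'a \<Rightarrow> 'a"
  assumes A: "multilinear sE sF k A" and k: "1 \<le> k"
  shows "(\<Sum>w\<in>{..<k} \<rightarrow>\<^sub>E {-1, 1}. sF (\<Prod>i<k. w i) (A (\<lambda>i\<in>{..<k}. \<Sum>j<k. sE (w j) (u j))))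
    = sF (of_nat (card ({..<k} \<rightarrow>\<^sub>E {-1, 1::'k})))
        (\<Sum>p | p permutes {..<k}. A (\<lambda>i\<in>{..<k}. u (p i)))"
proof -
  interpret F: vector_space sF
    using multilinear_vector_spaces[OF A k] by simp
  let ?W = "{..<k} \<rightarrow>\<^sub>E {-1, 1::'k}"
  let ?S = "{J \<in> {..<k} \<rightarrow>\<^sub>E {..<k}. inj_on J {..<k}}"
  have bij: "bij_betw (\<lambda>p. restrict p {..<k}) {p. p permutes {..<k}} ?S"
  proof (rule bij_betwI')
    fix p q assume "p \<in> {p. p permutes {..<k}}" "q \<in> {p. p permutes {..<k}}"
    then show "(restrict p {..<k} = restrict q {..<k}) = (p = q)"
      by (auto simp: fun_eq_iff restrict_def permutes_def) metis
  next
    fix p assume "p \<in> {p. p permutes {..<k}}"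
    then show "restrict p {..<k} \<in> ?S"
      using permutes_in_image[of p "{..<k}"] permutes_inj_on[of p "{..<k}"] by auto
  next
    fix J assume J: "J \<in> ?S"
    \<comment> \<open>Permutations fix everything outside \<open>{..<k}\<close>, whereas \<open>J\<close> is undefined there.\<close>
    let ?p = "\<lambda>i. if i \<in> {..<k} then J i else i"
    have "J ` {..<k} = {..<k}"
      using J by (intro endo_inj_surj) auto
    then have "bij_betw J {..<k} {..<k}"
      using J by (simp add: bij_betw_def)
    then have "bij_betw ?p {..<k} {..<k}"
      by (subst bij_betw_cong[where g = J]) auto
    then have "?p permutes {..<k}"
      by (rule bij_imp_permutes) auto
    moreover have "J = restrict ?p {..<k}"
      using J by (auto simp: fun_eq_iff PiE_iff extensional_def)
    ultimately show "\<exists>p\<in>{p. p permutes {..<k}}. J = restrict p {..<k}"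
      by blast
  qed
  have "(\<Sum>w\<in>?W. sF (\<Prod>i<k. w i) (A (\<lambda>i\<in>{..<k}. \<Sum>j<k. sE (w j) (u j))))
      = (\<Sum>J\<in>{..<k} \<rightarrow>\<^sub>E {..<k}. sF (\<Sum>w\<in>?W. (\<Prod>i<k. w i) * (\<Prod>i<k. w (J i)))
          (A (\<lambda>i\<in>{..<k}. u (J i))))"
    by (rule multilinear_sum_expand[OF A k finite_lessThan, where c = "\<lambda>w i j. w j"])
  also have "\<dots> = (\<Sum>J\<in>{..<k} \<rightarrow>\<^sub>E {..<k}.
      if inj_on J {..<k} then sF (of_nat (card ?W)) (A (\<lambda>i\<in>{..<k}. u (J i))) else 0)"
  proof (rule sum.cong)
    fix J assume J: "J \<in> {..<k} \<rightarrow>\<^sub>E {..<k}"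
    then have "(\<Sum>w\<in>?W. (\<Prod>i<k. w i) * (\<Prod>i<k. w (J i)))
      = (if inj_on J {..<k} then of_nat (card ?W) else 0)"
      by (intro sum_signs_prod) auto
    then show "sF (\<Sum>w\<in>?W. (\<Prod>i<k. w i) * (\<Prod>i<k. w (J i))) (A (\<lambda>i\<in>{..<k}. u (J i)))
      = (if inj_on J {..<k} then sF (of_nat (card ?W)) (A (\<lambda>i\<in>{..<k}. u (J i))) else 0)"
      by simp
  qed simp
  also have "\<dots> = (\<Sum>J\<in>?S. sF (of_nat (card ?W)) (A (\<lambda>i\<in>{..<k}. u (J i))))"
    by (intro sum.inter_filter[symmetric]) (simp add: finite_PiE)
  also have "\<dots> = (\<Sum>p | p permutes {..<k}.
      sF (of_nat (card ?W)) (A (\<lambda>i\<in>{..<k}. u (restrict p {..<k} i))))"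
    by (rule sum.reindex_bij_betw[OF bij, symmetric])
  also have "\<dots> = (\<Sum>p | p permutes {..<k}. sF (of_nat (card ?W)) (A (\<lambda>i\<in>{..<k}. u (p i))))"
    by (simp cong: restrict_cong)
  finally show ?thesis
    by (simp add: F.scale_sum_right)
qed

lemma norm_sum_permutations_le:
  fixes A :: "(nat \<Rightarrow> 'a::ab_group_add) \<Rightarrow> 'b::real_normed_vector"
    and sE :: "'k::real_normed_field \<Rightarrow> 'a \<Rightarrow> 'a"
  assumes A: "multilinear sE sF k A" and k: "1 \<le> k"
    and norm_sF: "\<And>c y. norm (sF c y) = norm c * norm y"
    and B: "\<And>w. (\<forall>i<k. norm (w i) \<le> 1) \<Longrightarrow> norm (A (\<lambda>i\<in>{..<k}. \<Sum>j<k. sE (w j) (u j))) \<le> B"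
  shows "norm (\<Sum>p | p permutes {..<k}. A (\<lambda>i\<in>{..<k}. u (p i))) \<le> B"
proof -
  let ?W = "{..<k} \<rightarrow>\<^sub>E {-1, 1::'k}"
  let ?S = "\<Sum>p | p permutes {..<k}. A (\<lambda>i\<in>{..<k}. u (p i))"
  have "of_nat (card ?W) * norm ?S = norm (sF (of_nat (card ?W)) ?S)"
    by (simp add: norm_sF)
  also have "\<dots> = norm (\<Sum>w\<in>?W. sF (\<Prod>i<k. w i) (A (\<lambda>i\<in>{..<k}. \<Sum>j<k. sE (w j) (u j))))"
    by (simp only: polarization[OF A k])
  also have "\<dots> \<le> of_nat (card ?W) * B"
  proof (rule sum_norm_bound)
    fix w assume w: "w \<in> ?W"
    have w1: "norm (w i) = 1" if "i < k" for i
      using PiE_mem[OF w, of i] that by auto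
    then have "norm (\<Prod>i<k. w i) = 1"
      by (simp add: prod_norm[symmetric])
    then show "norm (sF (\<Prod>i<k. w i) (A (\<lambda>i\<in>{..<k}. \<Sum>j<k. sE (w j) (u j)))) \<le> B"
      using B[of w] w1 by (simp add: norm_sF)
  qed
  finally have "of_nat (card ?W) * norm ?S \<le> of_nat (card ?W) * B" .
  moreover have "0 < card ?W"
    by (auto simp: card_gt_0_iff finite_PiE PiE_eq_empty_iff)
  ultimately show ?thesis
    by simp
qed

section \<open>The two inequalities\<close>

text \<open>
  Instead of the suprema, pointwise estimates suffice: \<open>M\<close> stands for any bound for the polynomial on the
  combinations of the \<open>x j\<close>. That the supremum is such a bound requires the values to be bounded, and
  the triangle inequality for the expansion provides that.
\<close>

lemma unconditional_boundI:
  fixes sE :: "'k::real_normed_field \<Rightarrow> 'a::real_normed_vector \<Rightarrow> 'a"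
    and sF :: "'k \<Rightarrow> 'b::real_normed_vector \<Rightarrow> 'b"
  assumes k: "1 \<le> k" and norm_sF: "\<And>c y. norm (sF c y) = norm c * norm y"
    and bound: "\<And>A (n::nat) x \<epsilon> M. multilinear sE sF k A \<Longrightarrow> \<forall>j<n. norm (\<epsilon> j) \<le> 1 \<Longrightarrow>
      (\<And>\<nu>. \<forall>j<n. norm (\<nu> j) \<le> 1 \<Longrightarrow> norm (A (\<lambda>i\<in>{..<k}. \<Sum>j<n. sE (\<nu> j) (x j))) \<le> M) \<Longrightarrow>
      norm (\<Sum>j<n. sF (\<epsilon> j) (A (\<lambda>i\<in>{..<k}. x j))) \<le> C * M"
  shows "unconditional_bound sE sF k C"
  unfolding unconditional_bound_def
proof (intro ballI allI)
  fix P :: "'a \<Rightarrow> 'b" and n :: nat and x :: "nat \<Rightarrow> 'a"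
  assume "P \<in> homogeneous_polynomials sE sF k"
  then obtain A where A: "multilinear sE sF k A" and P: "\<And>x. P x = A (\<lambda>i\<in>{..<k}. x)"
    unfolding homogeneous_polynomials_def by auto
  let ?cube = "{\<nu> :: nat \<Rightarrow> 'k. \<forall>j<n. norm (\<nu> j) \<le> 1}"
  have bdd: "bdd_above ((\<lambda>\<nu>. norm (P (\<Sum>j<n. sE (\<nu> j) (x j)))) ` ?cube)"
  proof (rule bdd_aboveI2)
    fix \<nu> assume \<nu>: "\<nu> \<in> ?cube"
    have "norm (P (\<Sum>j<n. sE (\<nu> j) (x j)))
        \<le> (\<Sum>J\<in>{..<k} \<rightarrow>\<^sub>E {..<n}. norm (sF (\<Prod>i<k. \<nu> (J i)) (A (\<lambda>i\<in>{..<k}. x (J i)))))"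
      unfolding P by (subst multilinear_expand[OF A k]) (auto intro: norm_sum)
    also have "\<dots> \<le> (\<Sum>J\<in>{..<k} \<rightarrow>\<^sub>E {..<n}. norm (A (\<lambda>i\<in>{..<k}. x (J i))))"
    proof (rule sum_mono)
      fix J assume J: "J \<in> {..<k} \<rightarrow>\<^sub>E {..<n}"
      have "(\<Prod>i<k. norm (\<nu> (J i))) \<le> 1"
        using \<nu> J by (intro prod_le_1) auto
      then show "norm (sF (\<Prod>i<k. \<nu> (J i)) (A (\<lambda>i\<in>{..<k}. x (J i)))) \<le> norm (A (\<lambda>i\<in>{..<k}. x (J i)))"
        by (simp add: norm_sF prod_norm[symmetric] mult_left_le_one_le prod_nonneg)
    qed
    finally show "norm (P (\<Sum>j<n. sE (\<nu> j) (x j)))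
        \<le> (\<Sum>J\<in>{..<k} \<rightarrow>\<^sub>E {..<n}. norm (A (\<lambda>i\<in>{..<k}. x (J i))))" .
  qed
  show "(SUP \<epsilon>\<in>?cube. norm (\<Sum>j<n. sF (\<epsilon> j) (P (x j))))
      \<le> C * (SUP \<nu>\<in>?cube. norm (P (\<Sum>j<n. sE (\<nu> j) (x j))))"
  proof (rule cSUP_least)
    have "(\<lambda>_. 0) \<in> ?cube"
      by simp
    then show "?cube \<noteq> {}"
      by (metis empty_iff)
    fix \<epsilon> assume "\<epsilon> \<in> ?cube"
    then have \<epsilon>: "\<forall>j<n. norm (\<epsilon> j) \<le> 1"
      by simp
    have "norm (A (\<lambda>i\<in>{..<k}. \<Sum>j<n. sE (\<nu> j) (x j)))
        \<le> (SUP \<nu>\<in>?cube. norm (P (\<Sum>j<n. sE (\<nu> j) (x j))))"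
      if "\<forall>j<n. norm (\<nu> j) \<le> 1" for \<nu>
      using cSUP_upper[OF _ bdd, of \<nu>] that by (simp add: P)
    from bound[OF A \<epsilon> this] show "norm (\<Sum>j<n. sF (\<epsilon> j) (P (x j)))
        \<le> C * (SUP \<nu>\<in>?cube. norm (P (\<Sum>j<n. sE (\<nu> j) (x j))))"
      by (simp only: P)
  qed
qed

lemma complex_root_exists:
  fixes a :: complex
  assumes "1 \<le> k"
  shows "\<exists>d. d ^ k = a"
proof
  show "rcis (root k (cmod a)) (Arg a / k) ^ k = a"
    using assms by (simp add: DeMoivre2 rcis_cmod_Arg)
qed

text \<open>
  The weights \<open>w j * d j\<close> are the same in every argument of \<open>A\<close>, so each term of the average is a
  value of the polynomial itself.
\<close>

lemma unconditional_bound_complex: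
  fixes sE :: "complex \<Rightarrow> 'a::real_normed_vector \<Rightarrow> 'a"
    and sF :: "complex \<Rightarrow> 'b::real_normed_vector \<Rightarrow> 'b"
  assumes k: "1 \<le> k" and norm_sF: "\<And>c y. norm (sF c y) = norm c * norm y"
  shows "unconditional_bound sE sF k 1"
proof (rule unconditional_boundI[OF k norm_sF])
  fix A :: "(nat \<Rightarrow> 'a) \<Rightarrow> 'b" and n x and \<epsilon> :: "nat \<Rightarrow> complex" and M
  assume A: "multilinear sE sF k A" and \<epsilon>: "\<forall>j<n. norm (\<epsilon> j) \<le> 1"
    and M: "\<And>\<nu>. \<forall>j<n. norm (\<nu> j) \<le> 1 \<Longrightarrow> norm (A (\<lambda>i\<in>{..<k}. \<Sum>j<n. sE (\<nu> j) (x j))) \<le> M"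
  let ?R = "{z::complex. z ^ k = 1}"
  let ?W = "{..<n} \<rightarrow>\<^sub>E ?R"
  have finR: "finite ?R"
    using k by (intro finite_roots_unity) simp
  have "\<forall>j. \<exists>d. d ^ k = \<epsilon> j"
    by (intro allI complex_root_exists k)
  from choice[OF this] obtain d where d: "\<And>j. d j ^ k = \<epsilon> j"
    by blast
  have norm_root: "norm z \<le> 1" if "norm (z ^ k) \<le> 1" for z :: complex
    using that k by (simp add: norm_power power_le_one_iff)
  let ?y = "\<Sum>j<n. sF (\<epsilon> j) (A (\<lambda>i\<in>{..<k}. x j))"
  have "(\<Sum>w\<in>?W. A (\<lambda>i\<in>{..<k}. \<Sum>j<n. sE (w j * d j) (x j))) = sF (of_nat (card ?W)) ?y"
  proof (rule multilinear_sum_diagonal[OF A k])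
    fix J assume J: "J \<in> {..<k} \<rightarrow>\<^sub>E {..<n}"
    have "(\<Sum>w\<in>?W. \<Prod>i<k. w (J i) * d (J i)) = (\<Sum>w\<in>?W. \<Prod>i<k. w (J i)) * (\<Prod>i<k. d (J i))"
      by (simp add: prod.distrib sum_distrib_right)
    also have "\<dots> = (if J constant_on {..<k} then of_nat (card ?W) * (\<Prod>i<k. d (J i)) else 0)"
      using J by (subst sum_roots_of_unity_prod[OF k]) auto
    also have "\<dots> = (if J constant_on {..<k} then of_nat (card ?W) * \<epsilon> (J 0) else 0)"
    proof -
      have "(\<Prod>i<k. d (J i)) = (\<Prod>i<k. d (J 0))" if "J constant_on {..<k}"
        using that k by (intro prod.cong refl arg_cong[where f = d]) (auto simp: constant_on_def)
      then show ?thesis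
        by (simp add: d)
    qed
    finally show "(\<Sum>w\<in>?W. \<Prod>i<k. w (J i) * d (J i))
      = (if J constant_on {..<k} then of_nat (card ?W) * \<epsilon> (J 0) else 0)" .
  qed simp
  then have "of_nat (card ?W) * norm ?y
      = norm (\<Sum>w\<in>?W. A (\<lambda>i\<in>{..<k}. \<Sum>j<n. sE (w j * d j) (x j)))"
    by (simp add: norm_sF)
  also have "\<dots> \<le> of_nat (card ?W) * M"
  proof (rule sum_norm_bound, rule M, intro allI impI)
    fix w j assume "w \<in> ?W" "j < n"
    then have "w j ^ k = 1"
      by auto
    then have "(w j * d j) ^ k = \<epsilon> j"
      by (simp add: power_mult_distrib d)
    with \<epsilon> \<open>j < n\<close> have "norm ((w j * d j) ^ k) \<le> 1"
      by (simp only:)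
    then show "norm (w j * d j) \<le> 1"
      by (rule norm_root)
  qed
  finally have "of_nat (card ?W) * norm ?y \<le> of_nat (card ?W) * M" .
  moreover have "(\<lambda>j\<in>{..<n}. 1) \<in> ?W"
    by auto
  then have "0 < card ?W"
    using finite_PiE[of "{..<n}" "\<lambda>_. ?R"] finR card_gt_0_iff by blast
  ultimately show "norm ?y \<le> 1 * M"
    by simp
qed

text \<open>
  Polarization evaluates the polynomial at sums of \<open>k\<close> vectors \<open>u r i\<close>, whose coefficients are bounded
  only by \<open>k\<close>; scaling them back into the unit cube gives the factor \<open>k\<^sup>k\<close>, and the
  number of permutations gives the denominator \<open>k!\<close>.
\<close>

lemma unconditional_bound_polarization_constant:
  fixes sE :: "'k::real_normed_field \<Rightarrow> 'a::real_normed_vector \<Rightarrow> 'a"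
    and sF :: "'k \<Rightarrow> 'b::real_normed_vector \<Rightarrow> 'b"
  assumes k: "1 \<le> k" and norm_sF: "\<And>c y. norm (sF c y) = norm c * norm y"
    and C: "real k ^ k / fact k \<le> C"
  shows "unconditional_bound sE sF k C"
proof (rule unconditional_boundI[OF k norm_sF])
  fix A :: "(nat \<Rightarrow> 'a) \<Rightarrow> 'b" and n x and \<epsilon> :: "nat \<Rightarrow> 'k" and M
  assume A: "multilinear sE sF k A" and \<epsilon>: "\<forall>j<n. norm (\<epsilon> j) \<le> 1"
    and M: "\<And>\<nu>. \<forall>j<n. norm (\<nu> j) \<le> 1 \<Longrightarrow> norm (A (\<lambda>i\<in>{..<k}. \<Sum>j<n. sE (\<nu> j) (x j))) \<le> M"
  interpret E: vector_space sE
    using multilinear_vector_spaces[OF A k] by simp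
  obtain m where m: "k = Suc m"
    using k by (cases k) auto
  let ?W = "{..<m} \<times> {..<n} \<rightarrow>\<^sub>E {-1, 1::'k}"
  let ?y = "\<Sum>j<n. sF (\<epsilon> j) (A (\<lambda>i\<in>{..<k}. x j))"
  define u where "u r i = (\<Sum>j<n. sE (entangled_signs m \<epsilon> r i j) (x j))" for r i
  \<comment> \<open>Permuting the arguments amounts to permuting the tuple \<open>J\<close>, and this preserves constancy.\<close>
  have avg: "(\<Sum>r\<in>?W. A (\<lambda>i\<in>{..<k}. u r (p i))) = sF (of_nat (card ?W)) ?y"
    if p: "p permutes {..<k}" for p
    unfolding u_def
  proof (rule multilinear_sum_diagonal[OF A k])
    fix J assume J: "J \<in> {..<k} \<rightarrow>\<^sub>E {..<n}"
    have ip: "inv p permutes {..<k}"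
      using p by (rule permutes_inv)
    have ip_lt: "inv p i < k \<longleftrightarrow> i < k" for i
      using permutes_in_image[OF ip, of i] by simp
    have "(\<Prod>i<k. entangled_signs m \<epsilon> r (p i) (J i))
        = (\<Prod>i<k. entangled_signs m \<epsilon> r i (J (inv p i)))" for r
      using prod.permute[OF ip, of "\<lambda>i. entangled_signs m \<epsilon> r (p i) (J i)"] permutes_inverses[OF p]
      by (simp add: o_def)
    then have "(\<Sum>r\<in>?W. \<Prod>i<k. entangled_signs m \<epsilon> r (p i) (J i))
        = (if (\<lambda>i. J (inv p i)) constant_on {..<k} then of_nat (card ?W) * \<epsilon> (J (inv p 0)) else 0)"
      unfolding m using J ip_lt m by (simp only:) (intro sum_entangled_signs_prod, auto)
    moreover have "(\<lambda>i. J (inv p i)) constant_on {..<k} \<longleftrightarrow> J constant_on {..<k}"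
    proof -
      have "(\<lambda>i. J (inv p i)) constant_on {..<k} \<longleftrightarrow> J constant_on (inv p ` {..<k})"
        by (auto simp: constant_on_def)
      then show ?thesis
        by (simp only: permutes_image[OF ip])
    qed
    moreover have "J (inv p 0) = J 0" if "J constant_on {..<k}"
      using that ip_lt[of 0] k by (auto simp: constant_on_def)
    ultimately show "(\<Sum>r\<in>?W. \<Prod>i<k. entangled_signs m \<epsilon> r (p i) (J i))
        = (if J constant_on {..<k} then of_nat (card ?W) * \<epsilon> (J 0) else 0)"
      by simp
  qed simp
  have sym_bound: "norm (\<Sum>p | p permutes {..<k}. A (\<lambda>i\<in>{..<k}. u r (p i))) \<le> real k ^ k * M"
    if r: "r \<in> ?W" for r
  proof (rule norm_sum_permutations_le[OF A k norm_sF])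
    fix w :: "nat \<Rightarrow> 'k" assume w: "\<forall>i<k. norm (w i) \<le> 1"
    \<comment> \<open>Division by \<open>k\<close> makes the coefficients of \<open>\<Sum>i. w i u i\<close> admissible.\<close>
    define \<nu> where "\<nu> j = (\<Sum>i<k. w i * entangled_signs m \<epsilon> r i j) / of_nat k" for j
    have norm_signs: "norm (entangled_signs m \<epsilon> r i j) \<le> 1" if "j < n" for i j
    proof -
      have r1: "norm (r (h, j)) = 1" if "h < m" for h
        using PiE_mem[OF r, of "(h, j)"] that \<open>j < n\<close> by auto
      then show ?thesis
        using \<epsilon> that by (simp add: entangled_signs_def norm_mult prod_norm[symmetric])
    qed
    have "norm (\<nu> j) \<le> 1" if "j < n" for j
    proof -
      have "norm (\<Sum>i<k. w i * entangled_signs m \<epsilon> r i j) \<le> of_nat (card {..<k}) * 1"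
        using w norm_signs[OF that] by (intro sum_norm_bound) (simp add: norm_mult mult_le_one)
      then show ?thesis
        using k by (simp add: \<nu>_def norm_divide divide_simps)
    qed
    then have \<nu>: "norm (A (\<lambda>i\<in>{..<k}. \<Sum>j<n. sE (\<nu> j) (x j))) \<le> M"
      by (intro M) simp
    have "(\<Sum>i<k. sE (w i) (u r i)) = (\<Sum>j<n. sE (\<Sum>i<k. w i * entangled_signs m \<epsilon> r i j) (x j))"
      unfolding u_def by (simp add: E.scale_sum_right E.scale_sum_left) (rule sum.swap)
    also have "\<dots> = sE (of_nat k) (\<Sum>j<n. sE (\<nu> j) (x j))"
      using k by (simp add: \<nu>_def E.scale_sum_right)
    finally show "norm (A (\<lambda>i\<in>{..<k}. \<Sum>j<k. sE (w j) (u r j))) \<le> real k ^ k * M"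
      using \<nu> by (simp add: multilinear_scale_diagonal[OF A k] norm_sF norm_power mult_left_mono)
  qed
  have "fact k * (of_nat (card ?W) * norm ?y)
      = norm (\<Sum>p | p permutes {..<k}. sF (of_nat (card ?W)) ?y)"
    by (simp add: sum_constant_scaleR norm_sF card_permutations del: sum_constant)
  also have "\<dots> = norm (\<Sum>p | p permutes {..<k}. \<Sum>r\<in>?W. A (\<lambda>i\<in>{..<k}. u r (p i)))"
    by (simp add: avg)
  also have "\<dots> = norm (\<Sum>r\<in>?W. \<Sum>p | p permutes {..<k}. A (\<lambda>i\<in>{..<k}. u r (p i)))"
    by (subst sum.swap) simp
  also have "\<dots> \<le> of_nat (card ?W) * (real k ^ k * M)"
    by (rule sum_norm_bound) (rule sym_bound)
  finally have "of_nat (card ?W) * (fact k * norm ?y) \<le> of_nat (card ?W) * (real k ^ k * M)"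
    by (simp only: mult.left_commute)
  moreover have "0 < card ?W"
    by (auto simp: card_gt_0_iff finite_PiE PiE_eq_empty_iff)
  ultimately have "fact k * norm ?y \<le> real k ^ k * M"
    by simp
  then have "norm ?y \<le> real k ^ k / fact k * M"
    by (simp add: field_simps)
  also have "\<dots> \<le> C * M"
  proof (rule mult_right_mono[OF C])
    show "0 \<le> M"
      by (rule order_trans[OF norm_ge_zero M[of "\<lambda>_. 0"]]) simp
  qed
  finally show "norm ?y \<le> C * M" .
qed

theorem lemma1:
  fixes k :: nat
  assumes "k \<ge> 1"
  shows
    "(\<exists>C. unconditional_bound
            (scaleR :: real \<Rightarrow> 'a \<Rightarrow> 'a::banach) (scaleR :: real \<Rightarrow> 'b \<Rightarrow> 'b::banach) k C)
     \<and> (\<exists>C. unconditional_bound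
            (scaleC :: complex \<Rightarrow> 'c \<Rightarrow> 'c::complex_banach)
            (scaleC :: complex \<Rightarrow> 'd \<Rightarrow> 'd::complex_banach) k C)
     \<and> unconditional_bound
            (scaleC :: complex \<Rightarrow> 'c \<Rightarrow> 'c) (scaleC :: complex \<Rightarrow> 'd \<Rightarrow> 'd) k 1
     \<and> unconditional_bound
            (scaleR :: real \<Rightarrow> 'a \<Rightarrow> 'a) (scaleR :: real \<Rightarrow> 'b \<Rightarrow> 'b) k
            ((2 * real k) ^ k / fact k)"
proof -
  have "real k ^ k / fact k \<le> (2 * real k) ^ k / fact k"
    by (intro divide_right_mono power_mono) simp_all
  then have "unconditional_bound
      (scaleR :: real \<Rightarrow> 'a \<Rightarrow> 'a) (scaleR :: real \<Rightarrow> 'b \<Rightarrow> 'b) k ((2 * real k) ^ k / fact k)"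
    using assms by (intro unconditional_bound_polarization_constant) simp_all
  moreover have "unconditional_bound
      (scaleC :: complex \<Rightarrow> 'c \<Rightarrow> 'c) (scaleC :: complex \<Rightarrow> 'd \<Rightarrow> 'd) k 1"
    using assms by (intro unconditional_bound_complex) (simp_all add: norm_scaleC)
  ultimately show ?thesis
    by blast
qed

end
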